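(* Let $\bar x\in\Omega$ (so that $T^F_\Omega(\bar x)<\infty$). Then $$\partial T^F_\Omega(\bar x)\subset N(\bar x;\Omega)\cap C^*.$$ This inclusion holds as an equality when the support function $\sigma_F$ is sequentially weak$^*$ continuous on the set $-[N(\bar x;\Omega)\cap C^*]$; in particular, when $\dim X<\infty$. If in addition (to the assumption $\bar x\in\Omega$) one has $0\in F$, then $$N(\bar x;\Omega)=\bigcup_{\lambda>0}\lambda\,\partial T^F_\Omega(\bar x).$$
   Context: $X$ is an arbitrary (real) Banach space with topological dual $X^*$ and pairing $\langle\cdot,\cdot\rangle$; $\xrightarrow{w^*}$ denotes weak$^*$ convergence of sequences in $X^*$. Standing assumptions: $\Omega\subset X$ is nonempty and closed; $F\subset X$ is nonempty, closed, bounded and convex (it is not assumed that $0\in\mathrm{int}\,F$). The minimal time function is $T^F_\Omega(x):=\inf\{t\ge 0\mid \Omega\cap(x+tF)\ne\emptyset\}\in[0,\infty]$, with $\inf\emptyset=\infty$. The support function of $F$ is $\sigma_F(x^* ):=\sup_{x\in F}\langle x^*,x\rangle$, $x^*\in X^*$, and $C^*:=\{x^*\in X^*\mid\sigma_F(-x^* )\le 1\}$. For $\varepsilon\ge0$ and $\Theta\subset X$, the set of $\varepsilon$-normals at $x\in\Theta$ is $\widehat N_\varepsilon(x;\Theta):=\{x^*\in X^*\mid \limsup_{u\to x,\,u\in\Theta}\frac{\langle x^*,u-x\rangle}{\|u-x\|}\le\varepsilon\}$, and $\widehat N_\varepsilon(x;\Theta):=\emptyset$ if $x\notin\Theta$.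 The basic (limiting) normal cone $N(\bar x;\Theta)$ is the set of $x^*\in X^*$ for which there are sequences $\varepsilon_k\downarrow0$, $x_k\to\bar x$, $x_k^*\xrightarrow{w^*}x^*$ with $x_k^*\in\widehat N_{\varepsilon_k}(x_k;\Theta)$ for all $k$. For $\varphi:X\to(-\infty,\infty]$ and $x$ with $\varphi(x)<\infty$, $\widehat\partial_\varepsilon\varphi(x):=\{x^*\in X^*\mid\liminf_{u\to x}\frac{\varphi(u)-\varphi(x)-\langle x^*,u-x\rangle}{\|u-x\|}\ge-\varepsilon\}$. The basic subdifferential $\partial\varphi(\bar x)$ (for $\varphi(\bar x)<\infty$) is the set of $x^*$ for which there are sequences $\varepsilon_k\downarrow0$, $x_k\to\bar x$ with $\varphi(x_k)\to\varphi(\bar x)$, and $x_k^*\xrightarrow{w^*}x^*$ with $x_k^*\in\widehat\partial_{\varepsilon_k}\varphi(x_k)$ for all $k$. A function $\psi:X^*\to(-\infty,\infty]$ is sequentially weak$^*$ continuous at $x^*$ if $\psi(x_k^* )\to\psi(x^* )$ for every sequence $x_k^*\xrightarrow{w^*}x^*$ in $X^*$, and sequentially weak$^*$ continuous on a subset $S\subset X^*$ if it has this property at each point of $S$. *)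

theory Defs
  imports "HOL-Analysis.Analysis"
begin

text \<open>
  The dual of a real Banach space \<open>'a\<close> is the type \<open>'a \<Rightarrow>\<^sub>L real\<close>, the pairing is
  \<^const>\<open>blinfun_apply\<close>. Functions with values in \<open>(-\<infinity>, \<infinity>]\<close> are
  represented as \<^typ>\<open>ereal\<close>-valued functions.
\<close>

definition weak_star_tendsto ::
  "(nat \<Rightarrow> 'a::real_normed_vector \<Rightarrow>\<^sub>L real) \<Rightarrow> ('a \<Rightarrow>\<^sub>L real) \<Rightarrow> bool"
  where "weak_star_tendsto xs x \<longleftrightarrow>
    (\<forall>v. (\<lambda>k. blinfun_apply (xs k) v) \<longlonglongrightarrow> blinfun_apply x v)"

text \<open>The infimum of the empty set is \<open>\<infinity>\<close> in \<^typ>\<open>ereal\<close>.\<close>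

definition minimal_time :: "'a::real_normed_vector set \<Rightarrow> 'a set \<Rightarrow> 'a \<Rightarrow> ereal"
  where "minimal_time F \<Omega> x =
    Inf {ereal t | t. 0 \<le> t \<and> \<Omega> \<inter> (\<lambda>f. x + t *\<^sub>R f) ` F \<noteq> {}}"

definition support_fun :: "'a::real_normed_vector set \<Rightarrow> ('a \<Rightarrow>\<^sub>L real) \<Rightarrow> ereal"
  where "support_fun F x' = (SUP x\<in>F. ereal (blinfun_apply x' x))"

definition C_star :: "'a::real_normed_vector set \<Rightarrow> ('a \<Rightarrow>\<^sub>L real) set"
  where "C_star F = {x'. support_fun F (- x') \<le> 1}"

text \<open>
  If \<open>x\<close> is an isolated point of \<open>S\<close>, then \<^term>\<open>at x within S\<close> is the trivial filter, the
  upper limit is \<open>-\<infinity>\<close>, and every functional is an \<open>\<epsilon>\<close>-normal.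
\<close>

definition eps_normals :: "real \<Rightarrow> 'a::real_normed_vector \<Rightarrow> 'a set \<Rightarrow> ('a \<Rightarrow>\<^sub>L real) set"
  where "eps_normals \<epsilon> x S =
    (if x \<in> S
     then {x'. Limsup (at x within S) (\<lambda>u. ereal (blinfun_apply x' (u - x) / norm (u - x))) \<le> ereal \<epsilon>}
     else {})"

text \<open>Below, \<open>\<epsilon>\<^sub>k \<down> 0\<close> is \<^term>\<open>decseq \<epsilon> \<and> \<epsilon> \<longlonglongrightarrow> 0\<close>, which entails \<open>\<epsilon>\<^sub>k \<ge> 0\<close>.\<close>

definition normal_cone :: "'a::real_normed_vector \<Rightarrow> 'a set \<Rightarrow> ('a \<Rightarrow>\<^sub>L real) set"
  where "normal_cone x S =
    {x'. \<exists>\<epsilon> xs xs'. decseq \<epsilon> \<and> \<epsilon> \<longlonglongrightarrow> 0 \<and> xs \<longlonglongrightarrow> x \<and> weak_star_tendsto xs' x' \<and>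
           (\<forall>k::nat. xs' k \<in> eps_normals (\<epsilon> k) (xs k) S)}"

text \<open>
  Both subdifferentials are set to be empty outside the domain of \<open>\<phi>\<close>; the values of \<open>\<phi>\<close>
  are assumed to be different from \<open>-\<infinity>\<close>.
\<close>

definition eps_subdiff ::
  "real \<Rightarrow> ('a::real_normed_vector \<Rightarrow> ereal) \<Rightarrow> 'a \<Rightarrow> ('a \<Rightarrow>\<^sub>L real) set"
  where "eps_subdiff \<epsilon> \<phi> x =
    (if \<phi> x < \<infinity>
     then {x'. Liminf (at x)
                 (\<lambda>u. (\<phi> u - \<phi> x - ereal (blinfun_apply x' (u - x))) / ereal (norm (u - x)))
               \<ge> ereal (- \<epsilon>)}
     else {})"

definition basic_subdiff ::
  "('a::real_normed_vector \<Rightarrow> ereal) \<Rightarrow> 'a \<Rightarrow> ('a \<Rightarrow>\<^sub>L real) set"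
  where "basic_subdiff \<phi> x =
    (if \<phi> x < \<infinity>
     then {x'. \<exists>\<epsilon> xs xs'. decseq \<epsilon> \<and> \<epsilon> \<longlonglongrightarrow> 0 \<and> xs \<longlonglongrightarrow> x \<and> (\<lambda>k. \<phi> (xs k)) \<longlonglongrightarrow> \<phi> x \<and>
                 weak_star_tendsto xs' x' \<and>
                 (\<forall>k::nat. xs' k \<in> eps_subdiff (\<epsilon> k) \<phi> (xs k))}
     else {})"

definition seq_weak_star_continuous_on ::
  "('a::real_normed_vector \<Rightarrow>\<^sub>L real) set \<Rightarrow> (('a \<Rightarrow>\<^sub>L real) \<Rightarrow> ereal) \<Rightarrow> bool"
  where "seq_weak_star_continuous_on S \<psi> \<longleftrightarrow>
    (\<forall>x'\<in>S. \<forall>xs'. weak_star_tendsto xs' x' \<longrightarrow> (\<lambda>k. \<psi> (xs' k)) \<longlonglongrightarrow> \<psi> x')"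

end

theory Submission
  imports Defs
begin

text \<open>
  Everything rests on two estimates relating \<open>\<epsilon>\<close>-normals of \<open>\<Omega>\<close> to \<open>\<epsilon>\<close>-subgradients of the minimal
  time function \<open>T\<close>; the limiting statements follow by passing to sequences.

  From subgradients to normals. Let \<open>x'\<close> be an \<open>\<epsilon>\<close>-subgradient of \<open>T\<close> at a point \<open>u\<close>, possibly outside \<open>\<Omega>\<close>.
  Pick a point \<open>w\<close> of \<open>\<Omega>\<close> that is reached from \<open>u\<close> in almost minimal time. Translating the trajectory
  shows that \<open>x'\<close>, minus a multiple of the distance from \<open>w\<close>, has an almost maximum on \<open>\<Omega>\<close> at \<open>w\<close>.
  Ekeland's variational principle turns this into an \<open>\<epsilon>'\<close>-normal at a nearby point of \<open>\<Omega>\<close>, with \<open>\<epsilon>'\<close> as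
  close to \<open>\<epsilon>\<close> as desired (\<open>eps_subgradient_imp_eps_normal_nearby\<close>). That \<open>x'\<close> is almost in \<open>C_star F\<close>
  comes from testing the subgradient inequality along the directions \<open>- f\<close> with \<open>f\<close> in \<open>F\<close>, where
  convexity of \<open>F\<close> bounds the growth of \<open>T\<close> (\<open>eps_subgradient_le_on_dynamics\<close>). Together these give
  the inclusion.

  From normals to subgradients. An \<open>\<epsilon>\<close>-normal \<open>x'\<close> at a point of \<open>\<Omega>\<close> that belongs to \<open>C_star F\<close> is a
  \<open>c * \<epsilon>\<close>-subgradient of \<open>T\<close> there, where \<open>c\<close> depends only on \<open>norm x'\<close> and on a bound for \<open>F\<close>
  (\<open>eps_normal_imp_eps_subgradient\<close>). By the uniform boundedness principle, \<open>c\<close> can be chosen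
  uniformly along a weak\<open>\<^sup>*\<close> convergent sequence. What remains is to bring the approximating normals
  into \<open>C_star F\<close> by scaling. If the support function is weak\<open>\<^sup>*\<close> continuous, factors tending to \<open>1\<close>
  suffice and the inclusion is an equality; this covers finite dimension, where bounded sets have
  bounded coordinates. In general a constant factor suffices, which yields the representation of the
  normal cone by multiples of subgradients.
\<close>

section \<open>Elementary properties of normals and subgradients\<close>

lemma weak_star_scaleR:
  assumes "weak_star_tendsto xs x'" and "l \<longlonglongrightarrow> m"
  shows "weak_star_tendsto (\<lambda>k. l k *\<^sub>R xs k) (m *\<^sub>R x')"
  using assms unfolding weak_star_tendsto_def
  by (simp add: scaleR_blinfun.rep_eq tendsto_mult)

text \<open>
  Multiplying the difference quotient out removes both the excluded point \<open>u = x\<close> and the case of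
  an isolated point from consideration, so that normals can be handled by plain inequalities.
\<close>

lemma eps_normals_iff:
  "x' \<in> eps_normals \<epsilon> x S \<longleftrightarrow> x \<in> S \<and>
    (\<forall>\<gamma>>\<epsilon>. \<exists>\<delta>>0. \<forall>u\<in>S. norm (u - x) < \<delta> \<longrightarrow> blinfun_apply x' (u - x) \<le> \<gamma> * norm (u - x))"
proof -
  let ?q = "\<lambda>u. blinfun_apply x' (u - x) / norm (u - x)"
  have pt: "blinfun_apply x' (u - x) \<le> \<gamma> * norm (u - x) \<longleftrightarrow> u = x \<or> ?q u \<le> \<gamma>" for u \<gamma>
    by (cases "u = x") (auto simp: blinfun.zero_right divide_le_eq)
  have "Limsup (at x within S) (\<lambda>u. ereal (?q u)) \<le> ereal \<epsilon> \<longleftrightarrow>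
      (\<forall>\<gamma>>\<epsilon>. eventually (\<lambda>u. ?q u \<le> \<gamma>) (at x within S))" (is "?L \<longleftrightarrow> ?R")
  proof
    assume L: ?L
    show ?R
    proof (intro allI impI)
      fix \<gamma> assume "\<epsilon> < \<gamma>"
      then have "ereal \<epsilon> < ereal \<gamma>" by simp
      with L have "eventually (\<lambda>u. ereal (?q u) < ereal \<gamma>) (at x within S)"
        unfolding Limsup_le_iff by blast
      then show "eventually (\<lambda>u. ?q u \<le> \<gamma>) (at x within S)"
        by eventually_elim simp
    qed
  next
    assume R: ?R
    show ?L unfolding Limsup_le_iff
    proof (intro allI impI)
      fix y assume "ereal \<epsilon> < y"
      then obtain \<gamma> where "\<epsilon> < \<gamma>" "ereal \<gamma> < y"
        by (metis ereal_dense2 less_ereal.simps(1))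
      with R have "eventually (\<lambda>u. ?q u \<le> \<gamma>) (at x within S)" by blast
      then show "eventually (\<lambda>u. ereal (?q u) < y) (at x within S)"
        by eventually_elim (use \<open>ereal \<gamma> < y\<close> in \<open>auto intro: le_less_trans[of _ "ereal \<gamma>"]\<close>)
    qed
  qed
  then show ?thesis
    unfolding eps_normals_def eventually_at pt by (auto simp: dist_norm; metis)
qed

lemma eps_normals_mono:
  assumes "x' \<in> eps_normals \<epsilon> x S" "\<epsilon> \<le> \<eta>"
  shows "x' \<in> eps_normals \<eta> x S"
  using assms unfolding eps_normals_iff by (meson le_less_trans)

lemma eps_normals_scaleR:
  assumes "x' \<in> eps_normals \<epsilon> x S" "0 < l"
  shows "l *\<^sub>R x' \<in> eps_normals (l * \<epsilon>) x S"
  unfolding eps_normals_iff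
proof (intro conjI allI impI)
  show "x \<in> S" using assms by (simp add: eps_normals_iff)
  fix \<gamma> assume "l * \<epsilon> < \<gamma>"
  then have "\<epsilon> < \<gamma> / l" using \<open>0 < l\<close> by (simp add: less_divide_eq mult.commute)
  with assms obtain \<delta> where "0 < \<delta>"
    and *: "\<And>u. u \<in> S \<Longrightarrow> norm (u - x) < \<delta> \<Longrightarrow> blinfun_apply x' (u - x) \<le> \<gamma> / l * norm (u - x)"
    unfolding eps_normals_iff by blast
  have "blinfun_apply (l *\<^sub>R x') (u - x) \<le> \<gamma> * norm (u - x)" if "u \<in> S" "norm (u - x) < \<delta>" for u
    using *[OF that] \<open>0 < l\<close> by (simp add: scaleR_blinfun.rep_eq field_simps)
  with \<open>0 < \<delta>\<close>
  show "\<exists>\<delta>>0. \<forall>u\<in>S. norm (u - x) < \<delta> \<longrightarrow> blinfun_apply (l *\<^sub>R x') (u - x) \<le> \<gamma> * norm (u - x)"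
    by blast
qed

lemma normal_cone_scaleR:
  assumes "x' \<in> normal_cone x S" "0 < l"
  shows "l *\<^sub>R x' \<in> normal_cone x S"
proof -
  obtain \<epsilon> xs xs' where *: "decseq \<epsilon>" "\<epsilon> \<longlonglongrightarrow> 0" "xs \<longlonglongrightarrow> x" "weak_star_tendsto xs' x'"
    "\<And>k. xs' k \<in> eps_normals (\<epsilon> k) (xs k) S"
    using assms unfolding normal_cone_def by blast
  have "decseq (\<lambda>k. l * \<epsilon> k)" using *(1) \<open>0 < l\<close> by (auto simp: decseq_def)
  moreover have "(\<lambda>k. l * \<epsilon> k) \<longlonglongrightarrow> 0" using tendsto_mult_right_zero[OF *(2)] .
  moreover have "weak_star_tendsto (\<lambda>k. l *\<^sub>R xs' k) (l *\<^sub>R x')"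
    using *(4) by (rule weak_star_scaleR) simp
  ultimately show ?thesis
    using *(3) eps_normals_scaleR[OF *(5) \<open>0 < l\<close>] unfolding normal_cone_def by blast
qed

text \<open>
  The assumption \<open>0 \<le> \<phi>\<close> keeps the value \<open>-\<infinity>\<close> away; at points where \<open>\<phi>\<close> is \<open>\<infinity>\<close> the inequality
  is trivially true, just as the extended quotient is \<open>\<infinity>\<close> there.
\<close>

lemma eps_subdiff_iff:
  assumes "\<And>u. 0 \<le> \<phi> u"
  shows "x' \<in> eps_subdiff \<epsilon> \<phi> x \<longleftrightarrow> \<phi> x < \<infinity> \<and>
    (\<forall>\<gamma>>\<epsilon>. \<exists>\<delta>>0. \<forall>u. norm (u - x) < \<delta> \<longrightarrow>
       \<phi> x + ereal (blinfun_apply x' (u - x) - \<gamma> * norm (u - x)) \<le> \<phi> u)"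
proof (cases "\<phi> x < \<infinity>")
  case True
  then obtain r where r: "\<phi> x = ereal r"
    using assms[of x] by (cases "\<phi> x") auto
  let ?q = "\<lambda>u. (\<phi> u - \<phi> x - ereal (blinfun_apply x' (u - x))) / ereal (norm (u - x))"
  have pt: "\<phi> x + ereal (blinfun_apply x' (u - x) - \<gamma> * norm (u - x)) \<le> \<phi> u \<longleftrightarrow>
      u = x \<or> ereal (- \<gamma>) \<le> ?q u" for u \<gamma>
  proof (cases "u = x")
    case False
    then show ?thesis
      using assms[of u] by (cases "\<phi> u") (auto simp: r field_simps)
  qed (auto simp: blinfun.zero_right r)
  have "ereal (- \<epsilon>) \<le> Liminf (at x) ?q \<longleftrightarrow>
      (\<forall>\<gamma>>\<epsilon>. eventually (\<lambda>u. ereal (- \<gamma>) \<le> ?q u) (at x))" (is "?L \<longleftrightarrow> ?R")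
  proof
    assume L: ?L
    show ?R
    proof (intro allI impI)
      fix \<gamma> assume "\<epsilon> < \<gamma>"
      then have "ereal (- \<gamma>) < ereal (- \<epsilon>)" by simp
      with L have "eventually (\<lambda>u. ereal (- \<gamma>) < ?q u) (at x)"
        unfolding le_Liminf_iff by blast
      then show "eventually (\<lambda>u. ereal (- \<gamma>) \<le> ?q u) (at x)"
        by eventually_elim simp
    qed
  next
    assume R: ?R
    show ?L unfolding le_Liminf_iff
    proof (intro allI impI)
      fix y assume "y < ereal (- \<epsilon>)"
      then obtain g where "y < ereal g" "g < - \<epsilon>"
        by (metis ereal_dense2 less_ereal.simps(1))
      have "\<epsilon> < - g" using \<open>g < - \<epsilon>\<close> by simp
      with R have "eventually (\<lambda>u. ereal (- (- g)) \<le> ?q u) (at x)" by blast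
      then show "eventually (\<lambda>u. y < ?q u) (at x)"
        by eventually_elim (use \<open>y < ereal g\<close> in \<open>auto intro: less_le_trans[of _ "ereal g"]\<close>)
    qed
  qed
  then show ?thesis
    unfolding eps_subdiff_def pt using True by (auto simp: eventually_at dist_norm; metis)
qed (simp add: eps_subdiff_def)

section \<open>Ekeland's variational principle\<close>

text \<open>
  Call \<open>A y\<close> the set of points that improve on \<open>y\<close> by at least \<open>l\<close> times their distance from \<open>y\<close>. By the
  triangle inequality, passing to a point of \<open>A y\<close> shrinks the set. Repeatedly choosing a nearly
  optimal point of the current set gives a nested sequence of closed sets with diameters tending to
  \<open>0\<close>. Their common point \<open>w\<close> can be improved by no other point.
\<close>

lemma ekeland_variational_principle:
  fixes \<phi> :: "'a::complete_space \<Rightarrow> real"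
  assumes S: "closed S" "z \<in> S" and cont: "continuous_on S \<phi>"
    and near_min: "\<And>y. y \<in> S \<Longrightarrow> \<phi> z \<le> \<phi> y + e" and "0 < l"
  obtains w where "w \<in> S" "l * dist z w \<le> e" "\<And>y. y \<in> S \<Longrightarrow> \<phi> w \<le> \<phi> y + l * dist w y"
proof -
  define A where "A y = {v \<in> S. \<phi> v + l * dist v y \<le> \<phi> y}" for y
  have A_refl: "y \<in> A y" if "y \<in> S" for y using that by (simp add: A_def)
  have A_trans: "A v \<subseteq> A y" if "v \<in> A y" for v y
  proof
    fix u assume "u \<in> A v"
    moreover have "l * dist u y \<le> l * dist u v + l * dist v y"
      using \<open>0 < l\<close> dist_triangle[of u y v] by (simp flip: distrib_left)
    ultimately show "u \<in> A y" using that by (auto simp: A_def)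
  qed
  have A_closed: "closed (A y)" for y
  proof -
    have "closed (S \<inter> (\<lambda>v. \<phi> v + l * dist v y) -` {..\<phi> y})"
      by (intro continuous_closed_preimage continuous_intros cont S closed_atMost)
    moreover have "A y = S \<inter> (\<lambda>v. \<phi> v + l * dist v y) -` {..\<phi> y}"
      by (auto simp: A_def)
    ultimately show ?thesis by simp
  qed
  have "\<exists>v. v \<in> A y \<and> (\<forall>u\<in>A y. \<phi> v \<le> \<phi> u + (1/2)^n)" if "y \<in> S" for y and n :: nat
  proof -
    let ?I = "\<phi> ` A y"
    have bdd: "bdd_below ?I"
      by (rule bdd_belowI[of _ "\<phi> z - e"]) (use near_min in \<open>force simp: A_def\<close>)
    have "?I \<noteq> {}" using A_refl[OF that] by blast
    then obtain v where "v \<in> A y" "\<phi> v < Inf ?I + (1/2)^n"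
      using cInf_lessD[of ?I "Inf ?I + (1/2)^n"] by auto
    moreover have "Inf ?I \<le> \<phi> u" if "u \<in> A y" for u
      using bdd that by (auto intro: cInf_lower)
    ultimately show ?thesis by (intro exI[of _ v]) force
  qed
  then have "\<forall>p. \<exists>v. snd p \<in> S \<longrightarrow>
      v \<in> A (snd p) \<and> (\<forall>u\<in>A (snd p). \<phi> v \<le> \<phi> u + (1/2)^(fst p))"
    by blast
  then obtain h where h: "\<forall>p. snd p \<in> S \<longrightarrow>
      h p \<in> A (snd p) \<and> (\<forall>u\<in>A (snd p). \<phi> (h p) \<le> \<phi> u + (1/2)^(fst p))"
    by (rule choice[THEN exE])
  define g where "g n y = h (n, y)" for n y
  have g: "g n y \<in> A y" "u \<in> A y \<Longrightarrow> \<phi> (g n y) \<le> \<phi> u + (1/2)^n" if "y \<in> S" for y n u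
    using h[rule_format, of "(n, y)"] that by (simp_all add: g_def)
  define s where "s = rec_nat z g"
  have s_Suc: "s (Suc n) = g n (s n)" and s_0: "s 0 = z" for n by (simp_all add: s_def)
  have sS: "s n \<in> S" for n
    by (induction n) (use S g in \<open>auto simp: s_0 s_Suc A_def\<close>)
  have sA: "s (Suc n) \<in> A (s n)" for n using g(1)[OF sS] by (simp add: s_Suc)
  have diam: "l * dist v (s (Suc n)) \<le> (1/2)^n" if "v \<in> A (s (Suc n))" for v n
  proof -
    have "v \<in> A (s n)" using that A_trans[OF sA] by blast
    from g(2)[OF sS this, of n] that show ?thesis by (auto simp: A_def s_Suc)
  qed
  have "\<exists>a. \<Inter>(range (\<lambda>n. A (s n))) = {a}"
  proof (rule decreasing_closed_nest_sing)
    show "A (s n) \<noteq> {}" for n using A_refl[OF sS] by blast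
    show "A (s n) \<subseteq> A (s m)" if "m \<le> n" for m n
      using that by (induction rule: dec_induct) (use A_trans[OF sA] in auto)
    fix \<epsilon> :: real assume "0 < \<epsilon>"
    then obtain n where n: "(1/2)^n < l * \<epsilon> / 2"
      using real_arch_pow_inv[of "l * \<epsilon> / 2" "1/2"] \<open>0 < l\<close> by auto
    have "dist u v < \<epsilon>" if "u \<in> A (s (Suc n))" "v \<in> A (s (Suc n))" for u v
    proof -
      have "l * dist u v \<le> l * dist u (s (Suc n)) + l * dist v (s (Suc n))"
        using \<open>0 < l\<close> dist_triangle2[of u v] by (simp flip: distrib_left)
      also have "\<dots> < l * \<epsilon>" using diam[OF that(1)] diam[OF that(2)] n by linarith
      finally show ?thesis using \<open>0 < l\<close> by simp
    qed
    then show "\<exists>n. \<forall>x\<in>A (s n). \<forall>y\<in>A (s n). dist x y < \<epsilon>" by blast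
  qed (rule A_closed)
  then obtain w where w: "\<Inter>(range (\<lambda>n. A (s n))) = {w}" by blast
  then have wA: "w \<in> A (s n)" for n by blast
  show thesis
  proof
    show "w \<in> S" using wA[of 0] by (simp add: A_def)
    show "l * dist z w \<le> e"
      using wA[of 0] near_min[of w] by (auto simp: A_def s_0 dist_commute)
    fix y assume "y \<in> S"
    show "\<phi> w \<le> \<phi> y + l * dist w y"
    proof (rule ccontr)
      assume "\<not> ?thesis"
      with \<open>y \<in> S\<close> have "y \<in> A w" by (simp add: A_def dist_commute)
      with wA A_trans have "y \<in> \<Inter>(range (\<lambda>n. A (s n)))" by blast
      with w have "y = w" by blast
      with \<open>\<not> ?thesis\<close> show False by simp
    qed
  qed
qed

section \<open>Consequences of the Baire category theorem\<close>

text \<open>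
  Baire's theorem in the form that is used for two purposes below: uniform boundedness, and the
  finite-dimensional comparison of a norm with coordinates.
\<close>

lemma closed_cover_contains_ball:
  fixes K :: "nat \<Rightarrow> 'a::banach set"
  assumes "\<And>n. closed (K n)" and cover: "(\<Union>n. K n) = UNIV"
  obtains n w r where "0 < r" "ball w r \<subseteq> K n"
proof -
  have "\<exists>n. interior (K n) \<noteq> {}"
  proof (rule ccontr)
    assume "\<nexists>n. interior (K n) \<noteq> {}"
    then have "euclidean interior_of (\<Union>(range K)) = {}"
      by (intro Baire_category_alt)
        (use assms in \<open>auto simp: completely_metrizable_space_euclidean\<close>)
    then show False using cover by simp
  qed
  then show thesis using that by (metis ex_in_conv mem_interior)
qed

text \<open>
  The uniform boundedness principle: if all functionals are bounded by \<open>n\<close> on \<open>ball w r\<close>, then the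
  vector \<open>s *\<^sub>R v\<close>, a difference of two points of that ball, bounds them on a multiple of the unit ball.
\<close>

lemma weak_star_convergent_imp_bounded:
  fixes x' :: "'a::banach \<Rightarrow>\<^sub>L real"
  assumes "weak_star_tendsto xs x'"
  obtains M where "0 < M" "\<And>k. norm (xs k) \<le> M"
proof -
  define K where "K n = {v. \<forall>k. \<bar>blinfun_apply (xs k) v\<bar> \<le> real n}" for n
  have "closed (K n)" for n
    unfolding K_def by (intro closed_Collect_all closed_Collect_le continuous_intros)
  moreover have "(\<Union>n. K n) = UNIV"
  proof -
    have "\<exists>n. v \<in> K n" for v
    proof -
      have "Bseq (\<lambda>k. blinfun_apply (xs k) v)"
        using assms by (auto simp: weak_star_tendsto_def intro!: convergent_imp_Bseq convergentI)
      then obtain c where "\<And>k. \<bar>blinfun_apply (xs k) v\<bar> \<le> c"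
        by (auto simp: Bseq_def)
      moreover obtain n where "c \<le> real n" using real_arch_simple by blast
      ultimately show ?thesis unfolding K_def by (auto intro: order_trans)
    qed
    then show ?thesis by blast
  qed
  ultimately obtain n w r where r: "0 < r" and ball: "ball w r \<subseteq> K n"
    by (rule closed_cover_contains_ball)
  have "norm (xs k) \<le> 4 * real n / r" for k
  proof (rule norm_blinfun_bound)
    fix v
    show "norm (blinfun_apply (xs k) v) \<le> 4 * real n / r * norm v"
    proof (cases "v = 0")
      case False
      define s where "s = r / (2 * norm v)"
      have "0 < s" using r False by (simp add: s_def)
      have "w + s *\<^sub>R v \<in> ball w r" "w \<in> ball w r"
        using r False by (auto simp: dist_norm s_def)
      with ball have "\<bar>blinfun_apply (xs k) (w + s *\<^sub>R v)\<bar> \<le> real n" "\<bar>blinfun_apply (xs k) w\<bar> \<le> real n"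
        unfolding K_def by blast+
      then have "s * \<bar>blinfun_apply (xs k) v\<bar> \<le> 2 * real n"
        using \<open>0 < s\<close> by (simp add: blinfun.add_right blinfun.scaleR_right abs_if split: if_splits)
      then show ?thesis using r False by (simp add: s_def field_simps)
    qed (simp add: blinfun.zero_right)
  qed (use r in simp)
  then show thesis
    using r by (intro that[of "4 * real n / r + 1"]) (auto intro: add_nonneg_pos add_increasing2)
qed

text \<open>
  For growing \<open>n\<close>, the combinations with coordinates in \<open>[-n, n]\<close> form compact, hence closed, sets
  that cover the space, so one of them contains a ball. Differences of points of this ball are
  combinations with coordinates in \<open>[-2 n, 2 n]\<close>, and they include a positive multiple of \<open>F\<close>.
\<close>

lemma bounded_subset_bounded_combinations:
  fixes B F :: "'a::banach set"
  assumes "finite B" "span B = UNIV" "bounded F"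
  obtains R where "\<And>f. f \<in> F \<Longrightarrow> \<exists>c. (\<forall>b\<in>B. \<bar>c b\<bar> \<le> R) \<and> f = (\<Sum>b\<in>B. c b *\<^sub>R b)"
proof -
  define K where "K C R = {(\<Sum>b\<in>C. c b *\<^sub>R b) | c. \<forall>b\<in>C. \<bar>c b\<bar> \<le> R}" for C :: "'a set" and R :: real
  have "compact (K C R)" if "finite C" for C R
    using that
  proof induction
    case empty
    then show ?case by (simp add: K_def)
  next
    case (insert a C)
    have "K (insert a C) R = {u + v | u v. u \<in> (\<lambda>t. t *\<^sub>R a) ` {- R..R} \<and> v \<in> K C R}" (is "?L = ?R")
    proof
      show "?L \<subseteq> ?R" using insert by (fastforce simp: K_def abs_le_iff)
      show "?R \<subseteq> ?L"
      proof
        fix y assume "y \<in> ?R"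
        then obtain t c where *: "\<bar>t\<bar> \<le> R" "\<forall>b\<in>C. \<bar>c b\<bar> \<le> R" "y = t *\<^sub>R a + (\<Sum>b\<in>C. c b *\<^sub>R b)"
          by (fastforce simp: K_def abs_le_iff)
        define c' where "c' = c(a := t)"
        have "(\<Sum>b\<in>C. c' b *\<^sub>R b) = (\<Sum>b\<in>C. c b *\<^sub>R b)"
          using insert by (intro sum.cong) (auto simp: c'_def)
        then have "y = (\<Sum>b\<in>insert a C. c' b *\<^sub>R b)"
          using insert * by (simp add: c'_def)
        moreover have "\<forall>b\<in>insert a C. \<bar>c' b\<bar> \<le> R" using * by (simp add: c'_def)
        ultimately show "y \<in> ?L" unfolding K_def by blast
      qed
    qed
    moreover have "compact ((\<lambda>t. t *\<^sub>R a) ` {- R..R})"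
      by (intro compact_continuous_image continuous_intros) auto
    ultimately show ?case
      using compact_sums[of "(\<lambda>t. t *\<^sub>R a) ` {- R..R}" "K C R"] insert.IH by simp
  qed
  then have "closed (K B (real n))" for n using assms(1) by (simp add: compact_imp_closed)
  moreover have "(\<Union>n. K B (real n)) = UNIV"
  proof -
    have "\<exists>n. v \<in> K B (real n)" for v
    proof -
      have "v \<in> span B" using assms by simp
      then obtain c where c: "v = (\<Sum>b\<in>B. c b *\<^sub>R b)"
        using span_finite[OF assms(1)] by auto
      obtain n where n: "(\<Sum>b\<in>B. \<bar>c b\<bar>) \<le> real n" using real_arch_simple by blast
      have "\<bar>c b\<bar> \<le> real n" if "b \<in> B" for b
        using member_le_sum[of b B "\<lambda>b. \<bar>c b\<bar>"] that assms(1) n by auto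
      with c show ?thesis unfolding K_def by blast
    qed
    then show ?thesis by blast
  qed
  ultimately obtain n w r where r: "0 < r" and ball: "ball w r \<subseteq> K B (real n)"
    by (rule closed_cover_contains_ball)
  obtain m where m: "0 < m" "\<And>f. f \<in> F \<Longrightarrow> norm f \<le> m"
    using assms(3) bounded_pos by metis
  define s where "s = r / (2 * m)"
  have "0 < s" using r m by (simp add: s_def)
  show thesis
  proof
    fix f assume "f \<in> F"
    have "norm (s *\<^sub>R f) \<le> r / 2"
      using m(2)[OF \<open>f \<in> F\<close>] m(1) r by (simp add: s_def field_simps)
    then have "w + s *\<^sub>R f \<in> ball w r" "w \<in> ball w r"
      using r by (auto simp: dist_norm)
    with ball have "w + s *\<^sub>R f \<in> K B (real n)" "w \<in> K B (real n)" by blast+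
    then obtain c d where c: "\<forall>b\<in>B. \<bar>c b\<bar> \<le> real n" "w + s *\<^sub>R f = (\<Sum>b\<in>B. c b *\<^sub>R b)"
      and d: "\<forall>b\<in>B. \<bar>d b\<bar> \<le> real n" "w = (\<Sum>b\<in>B. d b *\<^sub>R b)"
      unfolding K_def by blast
    have "f = (1 / s) *\<^sub>R ((w + s *\<^sub>R f) - w)" using \<open>0 < s\<close> by simp
    also have "\<dots> = (1 / s) *\<^sub>R (\<Sum>b\<in>B. (c b - d b) *\<^sub>R b)"
      by (subst c(2), subst d(2)) (simp add: sum_subtractf scaleR_left_diff_distrib)
    also have "\<dots> = (\<Sum>b\<in>B. ((c b - d b) / s) *\<^sub>R b)"
      by (simp add: scaleR_sum_right)
    finally have "f = (\<Sum>b\<in>B. ((c b - d b) / s) *\<^sub>R b)" .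
    moreover have "\<bar>(c b - d b) / s\<bar> \<le> 2 * real n / s" if "b \<in> B" for b
    proof -
      have "\<bar>c b - d b\<bar> \<le> 2 * real n" using c(1) d(1) that by force
      then show ?thesis using \<open>0 < s\<close> by (simp add: divide_right_mono)
    qed
    ultimately show "\<exists>c. (\<forall>b\<in>B. \<bar>c b\<bar> \<le> 2 * real n / s) \<and> f = (\<Sum>b\<in>B. c b *\<^sub>R b)"
      by (intro exI[of _ "\<lambda>b. (c b - d b) / s"]) blast
  qed
qed

section \<open>The support function\<close>

lemma support_fun_le_iff: "support_fun F y \<le> ereal c \<longleftrightarrow> (\<forall>f\<in>F. blinfun_apply y f \<le> c)"
  by (simp add: support_fun_def SUP_le_iff)

lemma mem_C_star_iff: "x' \<in> C_star F \<longleftrightarrow> (\<forall>f\<in>F. - blinfun_apply x' f \<le> 1)"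
  using support_fun_le_iff[of F "- x'" 1]
  by (simp add: C_star_def one_ereal_def uminus_blinfun.rep_eq)

lemma support_fun_bounded:
  assumes "F \<noteq> {}" and "\<And>f. f \<in> F \<Longrightarrow> norm f \<le> M"
  shows "\<bar>support_fun F y\<bar> \<noteq> \<infinity>"
proof -
  have "support_fun F y \<le> ereal (norm y * M)"
    unfolding support_fun_le_iff
  proof
    fix f assume "f \<in> F"
    have "blinfun_apply y f \<le> norm y * norm f" using norm_blinfun[of y f] by simp
    also have "\<dots> \<le> norm y * M" using assms(2)[OF \<open>f \<in> F\<close>] by (simp add: mult_left_mono)
    finally show "blinfun_apply y f \<le> norm y * M" .
  qed
  moreover obtain f where "f \<in> F" using assms(1) by blast
  then have "ereal (blinfun_apply y f) \<le> support_fun F y"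
    unfolding support_fun_def by (rule SUP_upper)
  ultimately show ?thesis by auto
qed

text \<open>
  Convergence on a spanning set is uniform on \<open>F\<close>, because the coordinates of the points of \<open>F\<close> are
  bounded, and a supremum over \<open>F\<close> is continuous under uniform convergence.
\<close>

lemma finite_dim_support_fun_weak_star_continuous:
  fixes B F :: "'a::banach set"
  assumes "finite B" "span B = UNIV" "bounded F" "F \<noteq> {}"
  shows "seq_weak_star_continuous_on S (support_fun F)"
  unfolding seq_weak_star_continuous_on_def
proof (intro ballI allI impI)
  fix x' :: "'a \<Rightarrow>\<^sub>L real" and xs
  assume lim: "weak_star_tendsto xs x'"
  obtain R where R: "\<And>f. f \<in> F \<Longrightarrow> \<exists>c. (\<forall>b\<in>B. \<bar>c b\<bar> \<le> R) \<and> f = (\<Sum>b\<in>B. c b *\<^sub>R b)"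
    using bounded_subset_bounded_combinations[OF assms(1-3)] by blast
  obtain M where M: "\<And>f. f \<in> F \<Longrightarrow> norm f \<le> M" using assms(3) bounded_pos by metis
  define d where "d k = (\<Sum>b\<in>B. R * \<bar>blinfun_apply (xs k) b - blinfun_apply x' b\<bar>)" for k
  have "d \<longlonglongrightarrow> (\<Sum>b\<in>B. R * \<bar>blinfun_apply x' b - blinfun_apply x' b\<bar>)"
    unfolding d_def using lim
    by (intro tendsto_sum tendsto_mult tendsto_const tendsto_rabs tendsto_diff)
      (simp add: weak_star_tendsto_def)
  then have d0: "d \<longlonglongrightarrow> 0" by simp
  have close: "\<bar>blinfun_apply (xs k) f - blinfun_apply x' f\<bar> \<le> d k" if f: "f \<in> F" for f k
  proof -
    obtain c where c: "\<forall>b\<in>B. \<bar>c b\<bar> \<le> R" "f = (\<Sum>b\<in>B. c b *\<^sub>R b)" using R[OF f] by blast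
    have "blinfun_apply (xs k) f - blinfun_apply x' f =
        (\<Sum>b\<in>B. c b * (blinfun_apply (xs k) b - blinfun_apply x' b))"
      by (simp add: c(2) blinfun.sum_right blinfun.scaleR_right right_diff_distrib sum_subtractf)
    also have "\<bar>\<dots>\<bar> \<le> d k"
      unfolding d_def using c(1)
      by (intro order_trans[OF sum_abs] sum_mono) (auto simp: abs_mult mult_right_mono)
    finally show ?thesis .
  qed
  define \<sigma> where "\<sigma> y = real_of_ereal (support_fun F y)" for y
  have \<sigma>: "support_fun F y = ereal (\<sigma> y)" for y
    using support_fun_bounded[OF assms(4) M] by (simp add: \<sigma>_def ereal_real)
  have \<sigma>_le: "\<sigma> y \<le> c \<longleftrightarrow> (\<forall>f\<in>F. blinfun_apply y f \<le> c)" for y c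
    using support_fun_le_iff[of F y c] by (simp add: \<sigma>)
  have 1: "\<sigma> (xs k) \<le> \<sigma> x' + d k" for k
    unfolding \<sigma>_le[of "xs k"]
  proof
    fix f assume f: "f \<in> F"
    from \<sigma>_le[of x' "\<sigma> x'"] f have "blinfun_apply x' f \<le> \<sigma> x'" by blast
    with close[OF f, of k] show "blinfun_apply (xs k) f \<le> \<sigma> x' + d k" by linarith
  qed
  have 2: "\<sigma> x' \<le> \<sigma> (xs k) + d k" for k
    unfolding \<sigma>_le[of x']
  proof
    fix f assume f: "f \<in> F"
    from \<sigma>_le[of "xs k" "\<sigma> (xs k)"] f have "blinfun_apply (xs k) f \<le> \<sigma> (xs k)" by blast
    with close[OF f, of k] show "blinfun_apply x' f \<le> \<sigma> (xs k) + d k" by linarith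
  qed
  have "(\<lambda>k. \<sigma> (xs k)) \<longlonglongrightarrow> \<sigma> x'"
  proof (rule LIM_zero_cancel, rule Lim_null_comparison[OF _ d0])
    show "\<forall>\<^sub>F k in sequentially. norm (\<sigma> (xs k) - \<sigma> x') \<le> d k"
      using 1 2 by (intro always_eventually allI) (simp add: abs_le_iff algebra_simps)
  qed
  then show "(\<lambda>k. support_fun F (xs k)) \<longlonglongrightarrow> support_fun F x'" by (simp add: \<sigma>)
qed

section \<open>The minimal time function\<close>

lemma minimal_time_nonneg: "0 \<le> minimal_time F \<Omega> x"
  unfolding minimal_time_def by (rule Inf_greatest) auto

lemma minimal_time_le:
  assumes "0 \<le> t" "f \<in> F" "x + t *\<^sub>R f \<in> \<Omega>"
  shows "minimal_time F \<Omega> x \<le> ereal t"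
  unfolding minimal_time_def by (rule Inf_lower) (use assms in auto)

lemma minimal_time_lessE:
  assumes "minimal_time F \<Omega> x < s"
  obtains t f where "0 \<le> t" "ereal t < s" "f \<in> F" "x + t *\<^sub>R f \<in> \<Omega>"
  using assms unfolding minimal_time_def Inf_less_iff by auto

lemma minimal_time_eq_0:
  assumes "F \<noteq> {}" "x \<in> \<Omega>"
  shows "minimal_time F \<Omega> x = 0"
proof -
  from assms obtain f where "f \<in> F" by blast
  with minimal_time_le[of 0 f F x \<Omega>] assms minimal_time_nonneg[of F \<Omega> x]
  show ?thesis by (simp add: zero_ereal_def)
qed

text \<open>
  From \<open>x - s *\<^sub>R f\<close> one reaches \<open>x\<close> in time \<open>s\<close>, and then \<open>\<Omega>\<close> in time \<open>t\<close> along some \<open>g\<close>. Convexity of \<open>F\<close>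
  replaces this broken path by a straight one of duration \<open>s + t\<close>.
\<close>

lemma minimal_time_step:
  assumes "convex F" "f \<in> F" "0 \<le> s"
  shows "minimal_time F \<Omega> (x - s *\<^sub>R f) \<le> minimal_time F \<Omega> x + ereal s"
proof (rule ccontr)
  assume "\<not> ?thesis"
  then have "minimal_time F \<Omega> x < minimal_time F \<Omega> (x - s *\<^sub>R f) - ereal s"
    by (simp add: not_le ereal_less_minus)
  then obtain t g where t: "0 \<le> t" "ereal t < minimal_time F \<Omega> (x - s *\<^sub>R f) - ereal s"
    and g: "g \<in> F" and \<Omega>: "x + t *\<^sub>R g \<in> \<Omega>" by (rule minimal_time_lessE)
  have "\<exists>h\<in>F. (s + t) *\<^sub>R h = s *\<^sub>R f + t *\<^sub>R g"
  proof (cases "s + t = 0")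
    case True
    then have "s = 0" "t = 0" using assms t by auto
    then show ?thesis using assms by (intro bexI[of _ f]) auto
  next
    case False
    then have "0 < s + t" using assms t by simp
    then have "(s / (s + t)) *\<^sub>R f + (t / (s + t)) *\<^sub>R g \<in> F"
      using assms g t by (intro convexD) (auto simp flip: add_divide_distrib)
    then show ?thesis
      using \<open>0 < s + t\<close> by (intro bexI) (auto simp: scaleR_right_distrib)
  qed
  then obtain h where "h \<in> F" "(s + t) *\<^sub>R h = s *\<^sub>R f + t *\<^sub>R g" by blast
  then have "minimal_time F \<Omega> (x - s *\<^sub>R f) \<le> ereal (s + t)"
    using \<Omega> assms t by (intro minimal_time_le[of _ h]) auto
  with t(2) show False
    by (cases "minimal_time F \<Omega> (x - s *\<^sub>R f)") auto
qed

section \<open>From normals to subgradients\<close>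

text \<open>
  Suppose that from \<open>u\<close> near \<open>x\<close> one reaches \<open>w = u + t *\<^sub>R f\<close> in \<open>\<Omega>\<close> so quickly that the subgradient
  inequality fails at \<open>u\<close>. Then \<open>t\<close> is at most \<open>norm x' * norm (u - x)\<close>, so \<open>w\<close> is near \<open>x\<close> too,
  with \<open>norm (w - x)\<close> at most \<open>1 + norm x' * M\<close> times \<open>norm (u - x)\<close>. The normal inequality
  at \<open>w\<close> together with \<open>- x' f \<le> 1\<close> then forces \<open>t\<close> to be larger than it was supposed to be.
  The factor in \<open>\<eta>\<close> depends on \<open>x'\<close> only through its norm, which is what makes the estimate survive a
  weak\<open>\<^sup>*\<close> limit.
\<close>

lemma eps_normal_imp_eps_subgradient:
  assumes normal: "x' \<in> eps_normals \<epsilon> x \<Omega>" and "0 \<le> \<epsilon>" and "F \<noteq> {}"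
    and C: "x' \<in> C_star F" and M: "0 \<le> M" "\<And>f. f \<in> F \<Longrightarrow> norm f \<le> M"
    and \<eta>: "\<epsilon> * (1 + norm x' * M) \<le> \<eta>"
  shows "x' \<in> eps_subdiff \<eta> (minimal_time F \<Omega>) x"
  unfolding eps_subdiff_iff[OF minimal_time_nonneg]
proof (intro conjI allI impI)
  have "x \<in> \<Omega>" using normal by (simp add: eps_normals_iff)
  then have T0: "minimal_time F \<Omega> x = 0" using minimal_time_eq_0 \<open>F \<noteq> {}\<close> by blast
  then show "minimal_time F \<Omega> x < \<infinity>" by simp
  define c where "c = 1 + norm x' * M"
  have "1 \<le> c" using M by (simp add: c_def)
  fix \<gamma> assume "\<eta> < \<gamma>"
  then have "\<epsilon> * c < \<gamma>" using \<eta> by (simp add: c_def)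
  then have "\<epsilon> < \<gamma> / c" using \<open>1 \<le> c\<close> by (simp add: less_divide_eq)
  have "0 \<le> \<gamma>" using \<open>\<epsilon> * c < \<gamma>\<close> \<open>0 \<le> \<epsilon>\<close> \<open>1 \<le> c\<close>
    by (smt (verit) mult_nonneg_nonneg)
  obtain \<delta> where "0 < \<delta>"
    and \<delta>: "\<And>w. w \<in> \<Omega> \<Longrightarrow> norm (w - x) < \<delta> \<Longrightarrow> blinfun_apply x' (w - x) \<le> \<gamma> / c * norm (w - x)"
    using normal \<open>\<epsilon> < \<gamma> / c\<close> unfolding eps_normals_iff by blast
  show "\<exists>\<delta>>0. \<forall>u. norm (u - x) < \<delta> \<longrightarrow> minimal_time F \<Omega> x +
      ereal (blinfun_apply x' (u - x) - \<gamma> * norm (u - x)) \<le> minimal_time F \<Omega> u"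
  proof (intro exI conjI allI impI)
    show "0 < \<delta> / c" using \<open>0 < \<delta>\<close> \<open>1 \<le> c\<close> by simp
    fix u assume "norm (u - x) < \<delta> / c"
    then have small: "c * norm (u - x) < \<delta>" using \<open>1 \<le> c\<close> by (simp add: less_divide_eq mult.commute)
    have "ereal (blinfun_apply x' (u - x) - \<gamma> * norm (u - x)) \<le> minimal_time F \<Omega> u"
    proof (rule ccontr)
      assume "\<not> ?thesis"
      then obtain t f where t: "0 \<le> t" "t < blinfun_apply x' (u - x) - \<gamma> * norm (u - x)"
        and f: "f \<in> F" and w: "u + t *\<^sub>R f \<in> \<Omega>"
        by (auto simp: not_le elim: minimal_time_lessE)
      define w where "w = u + t *\<^sub>R f"
      have "t \<le> norm x' * norm (u - x)"
        using t norm_blinfun[of x' "u - x"] mult_nonneg_nonneg[OF \<open>0 \<le> \<gamma>\<close> norm_ge_zero[of "u - x"]]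
        by simp
      then have "norm (t *\<^sub>R f) \<le> (norm x' * norm (u - x)) * M"
        using t(1) M f by (auto intro: mult_mono)
      moreover have "norm (w - x) \<le> norm (u - x) + norm (t *\<^sub>R f)"
        using norm_triangle_ineq[of "u - x" "t *\<^sub>R f"] by (simp add: w_def algebra_simps)
      ultimately have wx: "norm (w - x) \<le> c * norm (u - x)"
        by (simp add: c_def algebra_simps)
      then have "blinfun_apply x' (w - x) \<le> \<gamma> / c * norm (w - x)"
        using small w by (intro \<delta>) (auto simp: w_def)
      also have "\<dots> \<le> \<gamma> / c * (c * norm (u - x))"
        using wx \<open>0 \<le> \<gamma>\<close> \<open>1 \<le> c\<close> by (intro mult_left_mono) auto
      also have "\<dots> = \<gamma> * norm (u - x)" using \<open>1 \<le> c\<close> by simp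
      finally have "blinfun_apply x' (u - x) + t * blinfun_apply x' f \<le> \<gamma> * norm (u - x)"
        by (simp add: w_def blinfun.add_right blinfun.diff_right blinfun.scaleR_right)
      moreover have "- t \<le> t * blinfun_apply x' f"
        using C f t(1) mult_left_mono[of "- blinfun_apply x' f" 1 t] by (auto simp: mem_C_star_iff)
      ultimately show False using t(2) by linarith
    qed
    then show "minimal_time F \<Omega> x + ereal (blinfun_apply x' (u - x) - \<gamma> * norm (u - x))
        \<le> minimal_time F \<Omega> u" by (simp add: T0)
  qed
qed

section \<open>From subgradients to normals\<close>

text \<open>
  Moving backwards along \<open>f\<close> for the time \<open>s\<close> increases the minimal time by at most \<open>s\<close>; inserting these
  points into the subgradient inequality and dividing by \<open>s\<close> gives the estimate.
\<close>

lemma eps_subgradient_le_on_dynamics: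
  assumes sub: "x' \<in> eps_subdiff \<epsilon> (minimal_time F \<Omega>) x" and "convex F" and f: "f \<in> F"
  shows "- blinfun_apply x' f \<le> 1 + \<epsilon> * norm f"
proof -
  have "- blinfun_apply x' f \<le> 1 + \<epsilon> * norm f + \<eta>" if "0 < \<eta>" for \<eta>
  proof -
    define \<gamma> where "\<gamma> = \<epsilon> + \<eta> / (norm f + 1)"
    have "\<epsilon> < \<gamma>" using that by (simp add: \<gamma>_def add_nonneg_pos)
    with sub obtain \<delta> where "0 < \<delta>" and \<delta>: "\<And>u. norm (u - x) < \<delta> \<Longrightarrow>
       minimal_time F \<Omega> x + ereal (blinfun_apply x' (u - x) - \<gamma> * norm (u - x)) \<le> minimal_time F \<Omega> u"
      and fin: "minimal_time F \<Omega> x < \<infinity>"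
      unfolding eps_subdiff_iff[OF minimal_time_nonneg] by blast
    define s where "s = \<delta> / (norm f + 1)"
    have "0 < s" using \<open>0 < \<delta>\<close> by (simp add: s_def add_nonneg_pos)
    have "norm f * \<delta> < (norm f + 1) * \<delta>" using \<open>0 < \<delta>\<close> by (simp add: distrib_right)
    then have "norm ((x - s *\<^sub>R f) - x) < \<delta>"
      using \<open>0 < s\<close> \<open>0 < \<delta>\<close> by (simp add: s_def divide_less_eq add_nonneg_pos mult.commute)
    have "minimal_time F \<Omega> x + ereal (s * (- blinfun_apply x' f - \<gamma> * norm f))
        \<le> minimal_time F \<Omega> (x - s *\<^sub>R f)"
      using \<delta>[OF \<open>norm ((x - s *\<^sub>R f) - x) < \<delta>\<close>] \<open>0 < s\<close>
      by (simp add: blinfun.minus_right blinfun.scaleR_right algebra_simps)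
    also have "\<dots> \<le> minimal_time F \<Omega> x + ereal s"
      using minimal_time_step[OF \<open>convex F\<close> f] \<open>0 < s\<close> by simp
    finally have "minimal_time F \<Omega> x + ereal (s * (- blinfun_apply x' f - \<gamma> * norm f))
        \<le> minimal_time F \<Omega> x + ereal s" .
    then have "s * (- blinfun_apply x' f - \<gamma> * norm f) \<le> s * 1"
      using fin minimal_time_nonneg[of F \<Omega> x] by (cases "minimal_time F \<Omega> x") auto
    then have "- blinfun_apply x' f \<le> 1 + \<gamma> * norm f"
      using \<open>0 < s\<close> by (simp only: mult_le_cancel_left_pos)
    also have "\<gamma> * norm f \<le> \<epsilon> * norm f + \<eta>"
      using that by (simp add: \<gamma>_def distrib_right divide_le_eq add_nonneg_pos)
    finally show ?thesis by simp
  qed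
  then show ?thesis by (rule field_le_epsilon)
qed

text \<open>
  If \<open>w\<^sub>0\<close> maximizes \<open>x' - \<gamma> * norm (\<cdot> - w\<^sub>0)\<close> on \<open>\<Omega>\<close> locally up to the error \<open>p\<^sup>2\<close>, Ekeland's principle
  moves \<open>w\<^sub>0\<close> by at most \<open>p\<close> to an exact local maximizer of a functional perturbed by a term with
  Lipschitz constant \<open>p\<close>. At such a point, \<open>x'\<close> is a normal up to the sum of the two slopes.
\<close>

lemma eps_normal_near_almost_maximizer:
  fixes \<Omega> :: "'a::banach set"
  assumes "closed \<Omega>" "w\<^sub>0 \<in> \<Omega>" "0 < p" "p < \<delta>" "0 \<le> \<gamma>"
    and almost: "\<And>y. y \<in> \<Omega> \<Longrightarrow> norm (y - w\<^sub>0) \<le> \<delta> \<Longrightarrow>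
      blinfun_apply x' (y - w\<^sub>0) \<le> \<gamma> * norm (y - w\<^sub>0) + p\<^sup>2"
  obtains w where "norm (w - w\<^sub>0) \<le> p" "x' \<in> eps_normals (\<gamma> + p) w \<Omega>"
proof -
  define S where "S = \<Omega> \<inter> cball w\<^sub>0 \<delta>"
  define \<phi> where "\<phi> y = \<gamma> * norm (y - w\<^sub>0) - blinfun_apply x' y" for y
  obtain w where "w \<in> S" and "p * dist w\<^sub>0 w \<le> p\<^sup>2"
    and w: "\<And>y. y \<in> S \<Longrightarrow> \<phi> w \<le> \<phi> y + p * dist w y"
  proof (rule ekeland_variational_principle[of S w\<^sub>0 \<phi> "p\<^sup>2" p])
    show "closed S" "w\<^sub>0 \<in> S" using assms by (auto simp: S_def)
    show "continuous_on S \<phi>" unfolding \<phi>_def by (intro continuous_intros)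
    show "\<phi> w\<^sub>0 \<le> \<phi> y + p\<^sup>2" if "y \<in> S" for y
      using almost[of y] that by (auto simp: S_def \<phi>_def dist_norm norm_minus_commute blinfun.diff_right)
  qed (use assms in auto)
  then have near: "norm (w - w\<^sub>0) \<le> p" using \<open>0 < p\<close>
    by (simp add: power2_eq_square dist_norm norm_minus_commute)
  moreover have "x' \<in> eps_normals (\<gamma> + p) w \<Omega>"
    unfolding eps_normals_iff
  proof (intro conjI allI impI exI ballI)
    show "w \<in> \<Omega>" using \<open>w \<in> S\<close> by (simp add: S_def)
    show "0 < \<delta> - p" using assms by simp
    fix \<gamma>' y assume "\<gamma> + p < \<gamma>'" "y \<in> \<Omega>" and y: "norm (y - w) < \<delta> - p"
    have tri: "norm (y - w\<^sub>0) \<le> norm (y - w) + norm (w - w\<^sub>0)"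
      using norm_triangle_ineq[of "y - w" "w - w\<^sub>0"] by simp
    with y near \<open>y \<in> \<Omega>\<close> have "y \<in> S" by (simp add: S_def dist_norm norm_minus_commute)
    from w[OF this] have "blinfun_apply x' (y - w) \<le>
        \<gamma> * (norm (y - w\<^sub>0) - norm (w - w\<^sub>0)) + p * norm (y - w)"
      by (simp add: \<phi>_def dist_norm norm_minus_commute blinfun.diff_right algebra_simps)
    also have "\<dots> \<le> \<gamma> * norm (y - w) + p * norm (y - w)"
      using tri \<open>0 \<le> \<gamma>\<close> by (intro add_right_mono mult_left_mono) auto
    also have "\<dots> \<le> \<gamma>' * norm (y - w)"
      using \<open>\<gamma> + p < \<gamma>'\<close> by (simp flip: distrib_right add: mult_right_mono)
    finally show "blinfun_apply x' (y - w) \<le> \<gamma>' * norm (y - w)" .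
  qed
  ultimately show thesis by (rule that)
qed

text \<open>
  This is the heart of the inclusion into the normal cone, since the points \<open>x\<close> that approximate
  a point of \<open>\<Omega>\<close> need not lie in \<open>\<Omega>\<close>. Let \<open>w\<^sub>0 = x + t *\<^sub>R f\<close> be a point of \<open>\<Omega>\<close> reached in almost minimal time
  \<open>t\<close>. For every \<open>y\<close> in \<open>\<Omega>\<close>, the translated point \<open>x + (y - w\<^sub>0)\<close> reaches \<open>y\<close> along the same \<open>f\<close> in the
  same time. So the subgradient inequality at \<open>x\<close> says that \<open>w\<^sub>0\<close> is almost a maximizer as in the
  preceding lemma.
\<close>

lemma eps_subgradient_imp_eps_normal_nearby:
  fixes \<Omega> :: "'a::banach set"
  assumes sub: "x' \<in> eps_subdiff \<epsilon> (minimal_time F \<Omega>) x" and "0 \<le> \<epsilon>" and "closed \<Omega>"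
    and M: "0 \<le> M" "\<And>f. f \<in> F \<Longrightarrow> norm f \<le> M"
    and s: "minimal_time F \<Omega> x < ereal s" and "0 < \<eta>"
  obtains w where "norm (w - x) \<le> s * M + \<eta>" "x' \<in> eps_normals (\<epsilon> + \<eta>) w \<Omega>"
proof -
  define \<gamma> where "\<gamma> = \<epsilon> + \<eta> / 2"
  have "\<epsilon> < \<gamma>" using \<open>0 < \<eta>\<close> by (simp add: \<gamma>_def)
  with sub obtain \<delta> where "0 < \<delta>" and \<delta>: "\<And>u. norm (u - x) < \<delta> \<Longrightarrow>
     minimal_time F \<Omega> x + ereal (blinfun_apply x' (u - x) - \<gamma> * norm (u - x)) \<le> minimal_time F \<Omega> u"
    unfolding eps_subdiff_iff[OF minimal_time_nonneg] by blast
  obtain r where r: "minimal_time F \<Omega> x = ereal r"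
    using s minimal_time_nonneg[of F \<Omega> x] by (cases "minimal_time F \<Omega> x") auto
  \<comment> \<open>The displacement \<open>p\<close> stays inside the ball of radius \<open>\<delta> / 2\<close> and adds up with \<open>\<gamma>\<close> to at
    most \<open>\<epsilon> + \<eta>\<close>.\<close>
  define p where "p = min (\<delta> / 4) (\<eta> / 2)"
  have p: "0 < p" "p < \<delta> / 2" "p \<le> \<eta> / 2" using \<open>0 < \<delta>\<close> \<open>0 < \<eta>\<close> by (auto simp: p_def)
  have "minimal_time F \<Omega> x < ereal (min s (r + p\<^sup>2))"
    using s p by (simp add: r)
  then obtain t f where t: "0 \<le> t" "t < s" "t < r + p\<^sup>2" and f: "f \<in> F" and "x + t *\<^sub>R f \<in> \<Omega>"
    by (rule minimal_time_lessE) auto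
  define w\<^sub>0 where "w\<^sub>0 = x + t *\<^sub>R f"
  obtain w where w: "norm (w - w\<^sub>0) \<le> p" "x' \<in> eps_normals (\<gamma> + p) w \<Omega>"
  proof (rule eps_normal_near_almost_maximizer[of \<Omega> w\<^sub>0 p "\<delta> / 2" \<gamma> x'])
    show "w\<^sub>0 \<in> \<Omega>" using \<open>x + t *\<^sub>R f \<in> \<Omega>\<close> by (simp add: w\<^sub>0_def)
    show "0 \<le> \<gamma>" using \<open>0 \<le> \<epsilon>\<close> \<open>\<epsilon> < \<gamma>\<close> by simp
    fix y assume y: "y \<in> \<Omega>" "norm (y - w\<^sub>0) \<le> \<delta> / 2"
    define u where "u = x + (y - w\<^sub>0)"
    have u: "u - x = y - w\<^sub>0" "u + t *\<^sub>R f = y" by (simp_all add: u_def w\<^sub>0_def)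
    have "ereal r + ereal (blinfun_apply x' (y - w\<^sub>0) - \<gamma> * norm (y - w\<^sub>0)) \<le> minimal_time F \<Omega> u"
      using \<delta>[of u] y \<open>0 < \<delta>\<close> by (simp add: r u)
    also have "\<dots> \<le> ereal t"
      by (rule minimal_time_le[OF t(1) f]) (use y in \<open>simp add: u\<close>)
    finally show "blinfun_apply x' (y - w\<^sub>0) \<le> \<gamma> * norm (y - w\<^sub>0) + p\<^sup>2"
      using t(3) by simp
  qed (use p \<open>closed \<Omega>\<close> in auto)
  show thesis
  proof
    have "norm (w - x) \<le> norm (w - w\<^sub>0) + norm (t *\<^sub>R f)"
      using norm_triangle_ineq[of "w - w\<^sub>0" "t *\<^sub>R f"] by (simp add: w\<^sub>0_def)
    moreover have "norm (t *\<^sub>R f) \<le> s * M"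
      using t M f by (auto intro: mult_mono)
    ultimately show "norm (w - x) \<le> s * M + \<eta>" using w(1) p \<open>0 < \<eta>\<close> by linarith
    have "\<gamma> + p \<le> \<epsilon> + \<eta>" using p by (simp add: \<gamma>_def)
    then show "x' \<in> eps_normals (\<epsilon> + \<eta>) w \<Omega>" using w(2) eps_normals_mono by blast
  qed
qed

section \<open>Limiting constructions\<close>

text \<open>
  Points carrying normals lie in \<open>\<Omega>\<close>, where the minimal time vanishes, so only the errors need care:
  a weak\<open>\<^sup>*\<close> convergent sequence is bounded, and one factor serves for all \<open>k\<close>.
\<close>

lemma normals_in_C_star_imp_basic_subgradient:
  fixes x :: "'a::banach"
  assumes "F \<noteq> {}" "bounded F" "x \<in> \<Omega>"
    and \<epsilon>: "decseq \<epsilon>" "\<epsilon> \<longlonglongrightarrow> 0" and "xs \<longlonglongrightarrow> x" and weak: "weak_star_tendsto xs' x'"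
    and normal: "\<And>k. xs' k \<in> eps_normals (\<epsilon> k) (xs k) \<Omega>" and C: "\<And>k. xs' k \<in> C_star F"
  shows "x' \<in> basic_subdiff (minimal_time F \<Omega>) x"
proof -
  obtain M where M: "0 < M" "\<And>f. f \<in> F \<Longrightarrow> norm f \<le> M" using \<open>bounded F\<close> bounded_pos by metis
  obtain N where N: "0 < N" "\<And>k. norm (xs' k) \<le> N"
    using weak_star_convergent_imp_bounded[OF weak] by blast
  have \<epsilon>_nonneg: "0 \<le> \<epsilon> k" for k using decseq_ge[OF \<epsilon>] .
  define \<eta> where "\<eta> k = \<epsilon> k * (1 + N * M)" for k
  have "decseq \<eta>" using \<epsilon>(1) M(1) N(1) by (auto simp: decseq_def \<eta>_def mult_right_mono)
  moreover have "\<eta> \<longlonglongrightarrow> 0" unfolding \<eta>_def using tendsto_mult_left_zero[OF \<epsilon>(2)] .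
  moreover have "xs' k \<in> eps_subdiff (\<eta> k) (minimal_time F \<Omega>) (xs k)" for k
  proof (rule eps_normal_imp_eps_subgradient[OF normal \<epsilon>_nonneg \<open>F \<noteq> {}\<close> C])
    show "\<epsilon> k * (1 + norm (xs' k) * M) \<le> \<eta> k"
      unfolding \<eta>_def using \<epsilon>_nonneg M N by (intro mult_left_mono add_left_mono mult_right_mono) auto
  qed (use M in auto)
  moreover have "minimal_time F \<Omega> (xs k) = 0" for k
    using normal[of k] minimal_time_eq_0[OF \<open>F \<noteq> {}\<close>] by (auto simp: eps_normals_iff)
  then have "(\<lambda>k. minimal_time F \<Omega> (xs k)) \<longlonglongrightarrow> minimal_time F \<Omega> x"
    using minimal_time_eq_0[OF \<open>F \<noteq> {}\<close> \<open>x \<in> \<Omega>\<close>] by simp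
  moreover have "minimal_time F \<Omega> x < \<infinity>"
    using minimal_time_eq_0[OF \<open>F \<noteq> {}\<close> \<open>x \<in> \<Omega>\<close>] by simp
  ultimately show ?thesis
    using \<open>xs \<longlonglongrightarrow> x\<close> weak unfolding basic_subdiff_def by auto
qed

text \<open>
  The nearby points of \<open>\<Omega>\<close> still tend to \<open>x\<close>, because the minimal times of the approximating points tend
  to the value \<open>0\<close> at \<open>x\<close> and \<open>F\<close> is bounded.
\<close>

lemma basic_subgradient_imp_normal_and_C_star:
  fixes x :: "'a::banach"
  assumes "F \<noteq> {}" "bounded F" "convex F" "closed \<Omega>" "x \<in> \<Omega>"
    and sub: "x' \<in> basic_subdiff (minimal_time F \<Omega>) x"
  shows "x' \<in> normal_cone x \<Omega> \<inter> C_star F"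
proof -
  have T0: "minimal_time F \<Omega> x = 0" using minimal_time_eq_0 assms by blast
  obtain \<epsilon> xs xs' where \<epsilon>: "decseq \<epsilon>" "\<epsilon> \<longlonglongrightarrow> 0" and xs: "xs \<longlonglongrightarrow> x"
    and T: "(\<lambda>k. minimal_time F \<Omega> (xs k)) \<longlonglongrightarrow> 0" and weak: "weak_star_tendsto xs' x'"
    and subk: "\<And>k. xs' k \<in> eps_subdiff (\<epsilon> k) (minimal_time F \<Omega>) (xs k)"
    using sub unfolding basic_subdiff_def T0 by (auto split: if_splits)
  have \<epsilon>_nonneg: "0 \<le> \<epsilon> k" for k using decseq_ge[OF \<epsilon>] .
  have "x' \<in> C_star F"
    unfolding mem_C_star_iff
  proof
    fix f assume "f \<in> F"
    have "(\<lambda>k. - blinfun_apply (xs' k) f) \<longlonglongrightarrow> - blinfun_apply x' f"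
      using weak by (simp add: weak_star_tendsto_def tendsto_minus)
    moreover have "(\<lambda>k. 1 + \<epsilon> k * norm f) \<longlonglongrightarrow> 1 + 0 * norm f"
      by (intro tendsto_intros \<epsilon>)
    ultimately show "- blinfun_apply x' f \<le> 1"
      using eps_subgradient_le_on_dynamics[OF subk \<open>convex F\<close> \<open>f \<in> F\<close>]
      by (intro LIMSEQ_le[of _ _ _ 1]) auto
  qed
  moreover have "x' \<in> normal_cone x \<Omega>"
  proof -
    obtain M where M: "0 < M" "\<And>f. f \<in> F \<Longrightarrow> norm f \<le> M" using \<open>bounded F\<close> bounded_pos by metis
    define \<eta> where "\<eta> k = inverse (real (Suc k))" for k
    \<comment> \<open>Adding \<open>\<eta> k\<close> makes the bound on the minimal time strict, also when \<open>xs k\<close> lies in \<open>\<Omega>\<close>.\<close>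
    define s where "s k = real_of_ereal (minimal_time F \<Omega> (xs k)) + \<eta> k" for k
    have \<eta>: "\<eta> \<longlonglongrightarrow> 0" "decseq \<eta>" "0 < \<eta> k" for k
      unfolding \<eta>_def using LIMSEQ_inverse_real_of_nat by (auto simp: decseq_def)
    have "minimal_time F \<Omega> (xs k) < ereal (s k)" for k
    proof -
      have "minimal_time F \<Omega> (xs k) < \<infinity>" using subk[of k] by (simp add: eps_subdiff_def split: if_splits)
      then show ?thesis
        using minimal_time_nonneg[of F \<Omega> "xs k"] \<eta>(3)[of k]
        by (cases "minimal_time F \<Omega> (xs k)") (auto simp: s_def)
    qed
    then have "\<exists>w. norm (w - xs k) \<le> s k * M + \<eta> k \<and> xs' k \<in> eps_normals (\<epsilon> k + \<eta> k) w \<Omega>" for k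
      using eps_subgradient_imp_eps_normal_nearby
        [OF subk[of k] \<epsilon>_nonneg \<open>closed \<Omega>\<close> less_imp_le[OF M(1)] M(2) _ \<eta>(3)[of k]] by blast
    then obtain ws where ws: "\<And>k. norm (ws k - xs k) \<le> s k * M + \<eta> k"
        "\<And>k. xs' k \<in> eps_normals (\<epsilon> k + \<eta> k) (ws k) \<Omega>"
      by metis
    have "(\<lambda>k. real_of_ereal (minimal_time F \<Omega> (xs k))) \<longlonglongrightarrow> 0"
      using lim_real_of_ereal[of "\<lambda>k. minimal_time F \<Omega> (xs k)" 0] T by (simp add: zero_ereal_def)
    then have bound: "(\<lambda>k. s k * M + \<eta> k) \<longlonglongrightarrow> (0 + 0) * M + 0"
      unfolding s_def by (intro tendsto_add tendsto_mult tendsto_const \<eta>)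
    have "(\<lambda>k. ws k - xs k) \<longlonglongrightarrow> 0"
    proof (rule Lim_null_comparison)
      show "\<forall>\<^sub>F k in sequentially. norm (ws k - xs k) \<le> s k * M + \<eta> k"
        using ws(1) by (intro always_eventually allI)
      show "(\<lambda>k. s k * M + \<eta> k) \<longlonglongrightarrow> 0" using bound by simp
    qed
    from tendsto_add[OF this xs] have "ws \<longlonglongrightarrow> x" by simp
    moreover have "decseq (\<lambda>k. \<epsilon> k + \<eta> k)"
      using \<epsilon>(1) \<eta>(2) by (auto simp: decseq_def add_mono)
    moreover have "(\<lambda>k. \<epsilon> k + \<eta> k) \<longlonglongrightarrow> 0"
      using tendsto_add[OF \<epsilon>(2) \<eta>(1)] by simp
    ultimately show ?thesis
      using weak ws(2) unfolding normal_cone_def by blast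
  qed
  ultimately show ?thesis by blast
qed

text \<open>
  The approximating normals satisfy \<open>\<sigma>\<^sub>F(- x'\<^sub>k) \<le> 1\<close> only in the limit. Weak\<open>\<^sup>*\<close> continuity makes
  the factors that push them into \<open>C_star F\<close> tend to \<open>1\<close>, so the limit \<open>x'\<close> is not affected.
\<close>

lemma normal_in_C_star_imp_basic_subgradient:
  fixes x :: "'a::banach"
  assumes "F \<noteq> {}" "bounded F" "x \<in> \<Omega>"
    and cont: "seq_weak_star_continuous_on (uminus ` (normal_cone x \<Omega> \<inter> C_star F)) (support_fun F)"
    and x': "x' \<in> normal_cone x \<Omega> \<inter> C_star F"
  shows "x' \<in> basic_subdiff (minimal_time F \<Omega>) x"
proof -
  obtain \<epsilon> xs xs' where \<epsilon>: "decseq \<epsilon>" "\<epsilon> \<longlonglongrightarrow> 0" and xs: "xs \<longlonglongrightarrow> x"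
    and weak: "weak_star_tendsto xs' x'" and normal: "\<And>k. xs' k \<in> eps_normals (\<epsilon> k) (xs k) \<Omega>"
    using x' unfolding normal_cone_def by blast
  obtain M where M: "\<And>f. f \<in> F \<Longrightarrow> norm f \<le> M" using \<open>bounded F\<close> bounded_pos by metis
  define \<sigma> where "\<sigma> y = real_of_ereal (support_fun F y)" for y
  have \<sigma>: "support_fun F y = ereal (\<sigma> y)" for y
    using support_fun_bounded[OF \<open>F \<noteq> {}\<close> M] by (simp add: \<sigma>_def ereal_real)
  define l where "l k = 1 / max 1 (\<sigma> (- xs' k))" for k
  have l: "0 < l k" "l k \<le> 1" for k by (auto simp: l_def)
  have "weak_star_tendsto (\<lambda>k. - xs' k) (- x')"
    using weak by (simp add: weak_star_tendsto_def uminus_blinfun.rep_eq tendsto_minus)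
  then have "(\<lambda>k. \<sigma> (- xs' k)) \<longlonglongrightarrow> \<sigma> (- x')"
    using cont x' by (auto simp: seq_weak_star_continuous_on_def \<sigma>)
  then have "l \<longlonglongrightarrow> 1 / max 1 (\<sigma> (- x'))"
    unfolding l_def by (intro tendsto_intros) auto
  moreover have "\<sigma> (- x') \<le> 1"
    using x' by (simp add: C_star_def \<sigma>)
  ultimately have "l \<longlonglongrightarrow> 1" by (simp add: max_absorb1)
  from weak_star_scaleR[OF weak this]
  have weak': "weak_star_tendsto (\<lambda>k. l k *\<^sub>R xs' k) x'" by simp
  have "l k *\<^sub>R xs' k \<in> eps_normals (\<epsilon> k) (xs k) \<Omega>" for k
  proof (rule eps_normals_mono)
    show "l k *\<^sub>R xs' k \<in> eps_normals (l k * \<epsilon> k) (xs k) \<Omega>"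
      by (rule eps_normals_scaleR[OF normal l(1)])
    show "l k * \<epsilon> k \<le> \<epsilon> k"
      using l[of k] decseq_ge[OF \<epsilon>, of k] by (simp add: mult_left_le_one_le)
  qed
  moreover have "l k *\<^sub>R xs' k \<in> C_star F" for k
    unfolding mem_C_star_iff
  proof
    fix f assume "f \<in> F"
    have "- blinfun_apply (xs' k) f \<le> \<sigma> (- xs' k)"
      using support_fun_le_iff[of F "- xs' k" "\<sigma> (- xs' k)"] \<open>f \<in> F\<close>
      by (simp add: \<sigma> uminus_blinfun.rep_eq)
    also have "\<dots> \<le> max 1 (\<sigma> (- xs' k))" by simp
    finally have "(- blinfun_apply (xs' k) f) / max 1 (\<sigma> (- xs' k)) \<le> 1"
      by (subst divide_le_eq_1_pos) auto
    then show "- blinfun_apply (l k *\<^sub>R xs' k) f \<le> 1"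
      by (simp add: l_def scaleR_blinfun.rep_eq)
  qed
  ultimately show ?thesis
    using normals_in_C_star_imp_basic_subgradient[OF assms(1-3) \<epsilon> xs weak'] by blast
qed

text \<open>
  The approximating normals are bounded, so a single positive factor brings all of them into
  \<open>C_star F\<close>; the limit is rescaled by the same factor.
\<close>

lemma normal_imp_scaled_basic_subgradient:
  fixes x :: "'a::banach"
  assumes "F \<noteq> {}" "bounded F" "x \<in> \<Omega>" and x': "x' \<in> normal_cone x \<Omega>"
  obtains l where "0 < l" "x' \<in> (\<lambda>y'. l *\<^sub>R y') ` basic_subdiff (minimal_time F \<Omega>) x"
proof -
  obtain \<epsilon> xs xs' where \<epsilon>: "decseq \<epsilon>" "\<epsilon> \<longlonglongrightarrow> 0" and xs: "xs \<longlonglongrightarrow> x"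
    and weak: "weak_star_tendsto xs' x'" and normal: "\<And>k. xs' k \<in> eps_normals (\<epsilon> k) (xs k) \<Omega>"
    using x' unfolding normal_cone_def by blast
  obtain M where M: "0 < M" "\<And>f. f \<in> F \<Longrightarrow> norm f \<le> M" using \<open>bounded F\<close> bounded_pos by metis
  obtain N where N: "0 < N" "\<And>k. norm (xs' k) \<le> N"
    using weak_star_convergent_imp_bounded[OF weak] by blast
  define l where "l = N * M"
  have "0 < l" using M N by (simp add: l_def)
  have "(1 / l) *\<^sub>R x' \<in> basic_subdiff (minimal_time F \<Omega>) x"
  proof (rule normals_in_C_star_imp_basic_subgradient[OF assms(1-3)])
    show "decseq (\<lambda>k. (1 / l) * \<epsilon> k)"
      using \<epsilon>(1) \<open>0 < l\<close> by (auto simp: decseq_def divide_right_mono)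
    show "(\<lambda>k. (1 / l) * \<epsilon> k) \<longlonglongrightarrow> 0" using tendsto_mult_right_zero[OF \<epsilon>(2)] .
    show "weak_star_tendsto (\<lambda>k. (1 / l) *\<^sub>R xs' k) ((1 / l) *\<^sub>R x')"
      using weak by (rule weak_star_scaleR) simp
    show "(1 / l) *\<^sub>R xs' k \<in> eps_normals ((1 / l) * \<epsilon> k) (xs k) \<Omega>" for k
      using normal \<open>0 < l\<close> by (intro eps_normals_scaleR) auto
    show "(1 / l) *\<^sub>R xs' k \<in> C_star F" for k
      unfolding mem_C_star_iff
    proof
      fix f assume "f \<in> F"
      have "- blinfun_apply (xs' k) f \<le> norm (xs' k) * norm f"
        using norm_blinfun[of "xs' k" f] by simp
      also have "\<dots> \<le> l" unfolding l_def using M N \<open>f \<in> F\<close> by (intro mult_mono) (auto intro: less_imp_le)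
      finally have "(- blinfun_apply (xs' k) f) / l \<le> 1"
        using \<open>0 < l\<close> by (subst divide_le_eq_1_pos) auto
      then show "- blinfun_apply ((1 / l) *\<^sub>R xs' k) f \<le> 1"
        by (simp add: scaleR_blinfun.rep_eq)
    qed
  qed (rule xs)
  then have "l *\<^sub>R ((1 / l) *\<^sub>R x') \<in> (\<lambda>y'. l *\<^sub>R y') ` basic_subdiff (minimal_time F \<Omega>) x"
    by (rule imageI)
  with \<open>0 < l\<close> show thesis by (intro that[of l]) auto
qed

theorem theorem5p2:
  fixes \<Omega> F :: "'a::banach set" and x :: 'a
  assumes "\<Omega> \<noteq> {}" and "closed \<Omega>"
    and "F \<noteq> {}" and "closed F" and "bounded F" and "convex F"
    and "x \<in> \<Omega>"
  shows "minimal_time F \<Omega> x < \<infinity>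
    \<and> basic_subdiff (minimal_time F \<Omega>) x \<subseteq> normal_cone x \<Omega> \<inter> C_star F
    \<and> (seq_weak_star_continuous_on (uminus ` (normal_cone x \<Omega> \<inter> C_star F)) (support_fun F)
         \<longrightarrow> basic_subdiff (minimal_time F \<Omega>) x = normal_cone x \<Omega> \<inter> C_star F)
    \<and> ((\<exists>B :: 'a set. finite B \<and> span B = UNIV)
         \<longrightarrow> basic_subdiff (minimal_time F \<Omega>) x = normal_cone x \<Omega> \<inter> C_star F)
    \<and> (0 \<in> F
         \<longrightarrow> normal_cone x \<Omega> =
             (\<Union>l\<in>{0<..}. (\<lambda>x'. l *\<^sub>R x') ` basic_subdiff (minimal_time F \<Omega>) x))"
proof -
  let ?T = "minimal_time F \<Omega>"
  have sub: "basic_subdiff ?T x \<subseteq> normal_cone x \<Omega> \<inter> C_star F"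
    using basic_subgradient_imp_normal_and_C_star assms by blast
  have eq: "basic_subdiff ?T x = normal_cone x \<Omega> \<inter> C_star F"
    if "seq_weak_star_continuous_on (uminus ` (normal_cone x \<Omega> \<inter> C_star F)) (support_fun F)"
    using sub normal_in_C_star_imp_basic_subgradient[OF assms(3,5,7) that] by blast
  have "basic_subdiff ?T x = normal_cone x \<Omega> \<inter> C_star F"
    if "\<exists>B :: 'a set. finite B \<and> span B = UNIV"
  proof -
    from that obtain B :: "'a set" where "finite B" "span B = UNIV" by blast
    then show ?thesis by (intro eq finite_dim_support_fun_weak_star_continuous[OF _ _ assms(5,3)])
  qed
  moreover have "normal_cone x \<Omega> = (\<Union>l\<in>{0<..}. (\<lambda>x'. l *\<^sub>R x') ` basic_subdiff ?T x)"
  proof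
    show "normal_cone x \<Omega> \<subseteq> (\<Union>l\<in>{0<..}. (\<lambda>x'. l *\<^sub>R x') ` basic_subdiff ?T x)"
    proof
      fix x' assume "x' \<in> normal_cone x \<Omega>"
      then obtain l where "0 < l" "x' \<in> (\<lambda>y'. l *\<^sub>R y') ` basic_subdiff ?T x"
        by (rule normal_imp_scaled_basic_subgradient[OF assms(3,5,7)])
      then show "x' \<in> (\<Union>l\<in>{0<..}. (\<lambda>x'. l *\<^sub>R x') ` basic_subdiff ?T x)" by blast
    qed
    show "(\<Union>l\<in>{0<..}. (\<lambda>x'. l *\<^sub>R x') ` basic_subdiff ?T x) \<subseteq> normal_cone x \<Omega>"
      using sub normal_cone_scaleR[where S = \<Omega> and x = x] by fastforce
  qed
  moreover have "?T x < \<infinity>" using minimal_time_eq_0[OF assms(3,7)] by simp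
  ultimately show ?thesis using sub eq by blast
qed

end
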